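(* Every extremal simplicial complex is vertex decomposable.
   Context: A simplicial complex $\Delta$ on a finite set is a set of subsets (faces) closed under taking subsets. The dimension of a face $\sigma$ is $|\sigma|-1$, the dimension of $\Delta$ is the biggest dimension of a face. Facets are maximal faces; $\Delta$ is pure if all facets have the same dimension. A pure simplicial complex $\Delta$ of dimension $d$ with $n$ facets is extremal if it has the least possible number of $(d-1)$-dimensional faces among all simplicial complexes with $n$ faces of dimension $d$. For a face $\sigma$, $\mathrm{lk}_\Delta\sigma=\{\tau\in\Delta:\tau\cap\sigma=\emptyset,\ \tau\cup\sigma\in\Delta\}$. For a vertex $x$, $\Delta\setminus x=\{\tau\in\Delta:x\notin\tau\}$. Vertex decomposability is defined inductively: a pure simplicial complex $\Delta$ is vertex decomposable if (1) $\Delta$ consists of the empty set only, or (2) $\Delta$ consists of a single vertex, or (3) for some vertex $x$ both $\mathrm{lk}_\Delta\{x\}$ and $\Delta\setminus x$ are pure and vertex decomposable. *)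

theory Defs
  imports Main
begin

definition simplicial_complex :: "'a set set \<Rightarrow> bool" where
  "simplicial_complex \<Delta> \<longleftrightarrow>
     (\<exists>V. finite V \<and> \<Delta> \<subseteq> Pow V) \<and> (\<forall>\<sigma>\<in>\<Delta>. \<forall>\<tau>. \<tau> \<subseteq> \<sigma> \<longrightarrow> \<tau> \<in> \<Delta>)"

text \<open>Dimensions are integers, so that the empty face has dimension \<open>-1\<close>.\<close>

definition face_dim :: "'a set \<Rightarrow> int" where
  "face_dim \<sigma> = int (card \<sigma>) - 1"

text \<open>Only meaningful for a complex that has a face at all, i.e. \<open>\<Delta> \<noteq> {}\<close>.\<close>

definition complex_dim :: "'a set set \<Rightarrow> int" where
  "complex_dim \<Delta> = Max (face_dim ` \<Delta>)"

definition faces_of_dim :: "int \<Rightarrow> 'a set set \<Rightarrow> 'a set set" where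
  "faces_of_dim k \<Delta> = {\<sigma>\<in>\<Delta>. face_dim \<sigma> = k}"

definition facets :: "'a set set \<Rightarrow> 'a set set" where
  "facets \<Delta> = {\<sigma>\<in>\<Delta>. \<forall>\<tau>\<in>\<Delta>. \<sigma> \<subseteq> \<tau> \<longrightarrow> \<tau> = \<sigma>}"

definition pure_complex :: "'a set set \<Rightarrow> bool" where
  "pure_complex \<Delta> \<longleftrightarrow> (\<forall>\<sigma>\<in>facets \<Delta>. \<forall>\<tau>\<in>facets \<Delta>. face_dim \<sigma> = face_dim \<tau>)"

definition link :: "'a set set \<Rightarrow> 'a set \<Rightarrow> 'a set set" where
  "link \<Delta> \<sigma> = {\<tau>\<in>\<Delta>. \<tau> \<inter> \<sigma> = {} \<and> \<tau> \<union> \<sigma> \<in> \<Delta>}"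

definition deletion :: "'a set set \<Rightarrow> 'a \<Rightarrow> 'a set set" where
  "deletion \<Delta> x = {\<tau>\<in>\<Delta>. x \<notin> \<tau>}"

inductive vertex_decomposable :: "'a set set \<Rightarrow> bool" where
  empty_face: "vertex_decomposable {{}}"
| single_vertex: "vertex_decomposable {{}, {x}}"
| shed: "vertex_decomposable \<Delta>"
  if "simplicial_complex \<Delta>" and "pure_complex \<Delta>" and "{x} \<in> \<Delta>"
    and "pure_complex (link \<Delta> {x})" and "vertex_decomposable (link \<Delta> {x})"
    and "pure_complex (deletion \<Delta> x)" and "vertex_decomposable (deletion \<Delta> x)"

text \<open>
  The competitors \<open>\<Gamma>\<close> range over complexes with vertices in \<open>nat\<close>, which up to isomorphism
  are all complexes on finite sets, whatever the vertex type of \<open>\<Delta>\<close> (which may be finite).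
  They may have faces of dimension larger than that of \<open>\<Delta>\<close>, and need not be pure.
  The condition \<open>\<Delta> \<noteq> {}\<close> excludes the void complex, which has no dimension.
\<close>

definition extremal :: "'a set set \<Rightarrow> bool" where
  "extremal \<Delta> \<longleftrightarrow>
     simplicial_complex \<Delta> \<and> \<Delta> \<noteq> {} \<and> pure_complex \<Delta> \<and>
     (let d = complex_dim \<Delta>; n = card (facets \<Delta>) in
        \<forall>\<Gamma> :: nat set set.
          simplicial_complex \<Gamma> \<and> card (faces_of_dim d \<Gamma>) = n \<longrightarrow>
          card (faces_of_dim (d - 1) \<Delta>) \<le> card (faces_of_dim (d - 1) \<Gamma>))"

end

theory Submission
  imports Defs
begin

text \<open>
  The facets of an extremal complex of dimension \<open>k\<close> form a family \<open>F\<close> of \<open>(k + 1)\<close>-sets whose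
  shadow (the \<open>k\<close>-sets contained in a member) is as small as the Kruskal--Katona theorem permits.
  Write \<open>kk k n\<close> for the least size of the shadow of \<open>n\<close> sets of size \<open>k\<close>. For a vertex \<open>x\<close>, let
  \<open>L\<close> be the family of the sets \<open>\<sigma> - {x}\<close> with \<open>x \<in> \<sigma> \<in> F\<close>, and \<open>D\<close> the family of the members of
  \<open>F\<close> that avoid \<open>x\<close>. Sorting the shadow by whether a set contains \<open>x\<close> gives
  \<open>|shadow F| = |L \<union> shadow D| + |shadow L| \<ge> kk (k + 1) |D| + kk k |L|\<close>.

  If \<open>|L| \<le> kk (k + 1) |D|\<close>, then an optimal family of \<open>|D|\<close> sets has room in its shadow for the base
  of a cone over \<open>|L|\<close> smaller sets, and therefore \<open>kk (k + 1) |F| \<le> kk (k + 1) |D| + kk k |L|\<close>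
  (lemma \<open>kk_cone\<close>). For an extremal \<open>F\<close> everything is then an equality: \<open>D\<close> and \<open>L\<close> are extremal
  again, and \<open>L \<subseteq> shadow D\<close>. The latter inclusion says that deleting \<open>x\<close> creates no small facets, so
  the link and the deletion of \<open>x\<close> are the complexes generated by \<open>L\<close> and \<open>D\<close>, and induction shows
  that both are vertex decomposable.

  If there are at least two facets, a vertex \<open>x\<close> of least degree has \<open>|L| \<le> kk (k + 1) |D|\<close>
  (lemma \<open>small_degree_vertex\<close>): its degree is at most the average degree, and \<open>D\<close> misses a vertex
  of \<open>F\<close>, so that \<open>|D|\<close> lies in the range where a double-counting type lower bound for \<open>kk\<close> applies.

  The function \<open>kk\<close> is introduced through its cascade recursion. That it is a lower bound for all
  shadows and that it satisfies the coning inequality are proved together by induction on the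
  size of the sets: the choice of a vertex of least degree derives the former from the latter, and
  submodularity of shadows, applied to permuted optimal families of smaller sets, derives the
  latter from the former.
\<close>

section \<open>The Kruskal--Katona function\<close>

definition layer :: "'a set \<Rightarrow> nat \<Rightarrow> 'a set set" where
  "layer V k = {\<sigma>. \<sigma> \<subseteq> V \<and> card \<sigma> = k}"

definition shadow :: "'a set set \<Rightarrow> 'a set set" where
  "shadow F = {\<sigma> - {x} |\<sigma> x. \<sigma> \<in> F \<and> x \<in> \<sigma>}"

text \<open>
  The cascade function of Kruskal and Katona: if \<open>n\<close> has the cascade representation
  \<open>(a\<^sub>k choose k) + (a\<^sub>j choose j) + \<dots>\<close> with \<open>j = k - 1\<close>, then \<open>kk k n\<close> is the same sum with all
  lower entries diminished by one. The description operator is well defined because the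
  values of \<open>a choose Suc k\<close>, from \<open>a = k\<close> on, cut the natural numbers into disjoint nonempty intervals.
  The recursion alone would give the empty family (\<open>a = k\<close>) the value \<open>k choose k\<close> instead of \<open>0\<close>.
\<close>

fun kk :: "nat \<Rightarrow> nat \<Rightarrow> nat" where
  "kk 0 n = 0"
| "kk (Suc k) n = (if n = 0 then 0 else
     let a = (THE a. a choose Suc k \<le> n \<and> n < Suc a choose Suc k)
     in (a choose k) + kk k (n - (a choose Suc k)))"

declare kk.simps(2) [simp del]

lemma kk_zero [simp]: "kk k 0 = 0"
  by (cases k) (auto simp: kk.simps(2))

lemma choose_mono_left:
  assumes "a \<le> b"
  shows "a choose k \<le> b choose k"
proof (cases k)
  case (Suc j)
  show ?thesis using assms unfolding Suc by (induction rule: dec_induct) auto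
qed simp

lemma choose_interval_unique:
  assumes "a choose k \<le> n" "n < Suc a choose k" "b choose k \<le> n" "n < Suc b choose k"
  shows "a = b"
proof (rule ccontr)
  assume "a \<noteq> b"
  then have "Suc a \<le> b \<or> Suc b \<le> a" by auto
  then show False
    using assms choose_mono_left[of "Suc a" b k] choose_mono_left[of "Suc b" a k] by auto
qed

lemma kk_rec_less:
  assumes "Suc k \<le> a" "r < a choose k"
  shows "kk (Suc k) ((a choose Suc k) + r) = (a choose k) + kk k r"
proof -
  have pos: "(a choose Suc k) + r > 0" using assms by (simp add: zero_less_binomial)
  have "(THE b. b choose Suc k \<le> (a choose Suc k) + r \<and> (a choose Suc k) + r < Suc b choose Suc k) = a"
    by (rule the_equality) (use assms choose_interval_unique in \<open>auto simp del: binomial_eq_0_iff\<close>)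
  then show ?thesis using pos unfolding kk.simps(2) Let_def by (metis add_diff_cancel_left' neq0_conv)
qed

lemma kk_choose:
  assumes "k \<le> a"
  shows "kk (Suc k) (Suc a choose Suc k) = Suc a choose k"
  using kk_rec_less[of k "Suc a" 0] assms by (simp del: binomial_Suc_Suc add: zero_less_binomial)

text \<open>
  Unlike in the cascade representation, the remainder may fill the whole next block: at
  \<open>r = a choose k\<close> the recursion passes to \<open>Suc a\<close>, and Pascal's rule makes both readings agree. This
  slack spares boundary cases later on.
\<close>

lemma kk_rec:
  assumes "Suc k \<le> a" "r \<le> a choose k"
  shows "kk (Suc k) ((a choose Suc k) + r) = (a choose k) + kk k r"
proof (cases "r = a choose k")
  case True
  then have "kk (Suc k) ((a choose Suc k) + r) = Suc a choose k"
    using kk_choose[of k a] assms by (simp add: add.commute)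
  also have "\<dots> = (a choose k) + kk k (a choose k)"
  proof (cases k)
    case (Suc j)
    with assms obtain b where "a = Suc b" "j \<le> b" by (cases a) auto
    with Suc kk_choose[of j b] show ?thesis by simp
  qed simp
  finally show ?thesis using True by simp
qed (use assms kk_rec_less in auto)

lemma choose_decomp:
  assumes "n > 0"
  obtains a r where "n = (a choose Suc k) + r" "r < a choose k" "Suc k \<le> a"
proof -
  from assms have "\<exists>a r. n = (a choose Suc k) + r \<and> r < a choose k \<and> Suc k \<le> a"
  proof (induction n rule: nat_induct_non_zero)
    case 1
    show ?case by (rule exI[of _ "Suc k"], rule exI[of _ 0]) simp
  next
    case (Suc n)
    then obtain a r where *: "n = (a choose Suc k) + r" "r < a choose k" "Suc k \<le> a" by blast
    show ?case
    proof (cases "Suc r < a choose k")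
      case True
      with * show ?thesis by (intro exI[of _ a] exI[of _ "Suc r"]) auto
    next
      case False
      with * have "Suc n = (Suc a choose Suc k) + 0" by simp
      moreover have "0 < Suc a choose k" using * by (simp add: zero_less_binomial)
      ultimately show ?thesis using * by (metis le_SucI)
    qed
  qed
  then show ?thesis using that by blast
qed

text \<open>
  The numerical form of the double count between \<open>n\<close> sets of size \<open>k\<close> on \<open>w\<close> points and their shadow:
  each set has \<open>k\<close> subsets of size \<open>k - 1\<close>, each of which has at most \<open>Suc w - k\<close> one-point extensions.
  For \<open>n = (a choose Suc k) + r\<close> with \<open>r > 0\<close> the
  worst case is \<open>w = Suc a\<close>. There the full layer of \<open>Suc k\<close>-sets meets the bound on \<open>a\<close> points with
  equality, and the additional point leaves \<open>a choose k\<close> to spare, more than \<open>r\<close>; the other \<open>k * r\<close>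
  are paid for by induction.
\<close>

lemma kk_local_bound:
  assumes "n \<le> w choose k"
  shows "k * n \<le> kk k n * (Suc w - k)"
  using assms
proof (induction k arbitrary: n w)
  case (Suc k)
  show ?case
  proof (cases "n = 0")
    case False
    then obtain a r where d: "n = (a choose Suc k) + r" "r < a choose k" "Suc k \<le> a"
      using choose_decomp by blast
    have kkn: "kk (Suc k) n = (a choose k) + kk k r" using d kk_rec by simp
    have absorb: "Suc k * (a choose Suc k) = (a choose k) * (a - k)"
      using binomial_absorb_comp[of a k] binomial_absorption[of k a]
      by (metis binomial_absorption binomial_absorb_comp mult.commute)
    show ?thesis
    proof (cases "a < w")
      case True
      have IH: "k * r \<le> kk k r * (Suc a - k)" using Suc.IH[of r a] d by simp
      have "Suc k * n = (a choose k) * (a - k) + r + k * r"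
        using d by (simp add: absorb add_mult_distrib2 mult_Suc[of k r] del: mult_Suc)
      also have "\<dots> \<le> (a choose k) * (a - k) + (a choose k) + kk k r * (Suc a - k)"
        using IH d by linarith
      also have "\<dots> = kk (Suc k) n * (Suc a - k)"
      proof -
        have "Suc a - k = Suc (a - k)" using d by (simp add: Suc_diff_le)
        then show ?thesis unfolding kkn by (simp add: add_mult_distrib)
      qed
      also have "\<dots> \<le> kk (Suc k) n * (Suc w - Suc k)"
        using True by (intro mult_le_mono2) auto
      finally show ?thesis .
    next
      case False
      have "n < Suc a choose Suc k" using d by simp
      moreover have "a choose Suc k \<ge> w choose Suc k" using False choose_mono_left by simp
      ultimately have "n = a choose Suc k" "r = 0" using d Suc.prems by auto
      moreover have "a = w"
      proof (rule ccontr)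
        assume "a \<noteq> w"
        with False have "Suc w \<le> a" by simp
        then have "Suc w choose Suc k \<le> a choose Suc k" using choose_mono_left by blast
        moreover have "w choose k > 0" using \<open>Suc w \<le> a\<close> Suc.prems d
          by (metis add_gr_0 binomial_eq_0_iff le_0_eq linorder_not_less not_less_eq_eq zero_less_binomial_iff less_SucI less_imp_le)
        ultimately show False using d Suc.prems by simp
      qed
      ultimately show ?thesis using absorb kkn by simp
    qed
  qed simp
qed simp

section \<open>Shadows\<close>

definition link_family :: "'a set set \<Rightarrow> 'a \<Rightarrow> 'a set set" where
  "link_family F x = {\<sigma> - {x} |\<sigma>. \<sigma> \<in> F \<and> x \<in> \<sigma>}"

definition deletion_family :: "'a set set \<Rightarrow> 'a \<Rightarrow> 'a set set" where
  "deletion_family F x = {\<sigma> \<in> F. x \<notin> \<sigma>}"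

lemma layer_finite: "finite V \<Longrightarrow> finite (layer V k)"
  unfolding layer_def by simp

lemma card_layer: "finite V \<Longrightarrow> card (layer V k) = card V choose k"
  unfolding layer_def by (rule n_subsets)

lemma layer_0: "finite V \<Longrightarrow> layer V 0 = {{}}"
  unfolding layer_def by (auto dest: finite_subset)

lemma shadow_layer:
  assumes "F \<subseteq> layer V (Suc k)" "finite V"
  shows "shadow F \<subseteq> layer V k"
  using assms unfolding shadow_def layer_def
  by (auto simp: card_Diff_singleton dest: finite_subset)

lemma shadow_layer0: "F \<subseteq> layer V 0 \<Longrightarrow> finite V \<Longrightarrow> shadow F = {}"
  unfolding layer_0 shadow_def by auto

lemma shadow_finite: "F \<subseteq> layer V k \<Longrightarrow> finite V \<Longrightarrow> finite (shadow F)"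
  by (cases k) (use shadow_layer0 shadow_layer layer_finite finite_subset in \<open>metis finite.emptyI\<close>)+

lemma deletion_family_layer: "F \<subseteq> layer V k \<Longrightarrow> deletion_family F x \<subseteq> layer (V - {x}) k"
  unfolding deletion_family_def layer_def by auto

lemma link_family_layer:
  "F \<subseteq> layer V (Suc k) \<Longrightarrow> finite V \<Longrightarrow> link_family F x \<subseteq> layer (V - {x}) k"
  unfolding link_family_def layer_def by (auto simp: card_Diff_singleton dest: finite_subset)

lemma card_link_family: "card (link_family F x) = card {\<sigma> \<in> F. x \<in> \<sigma>}"
proof -
  have "link_family F x = (\<lambda>\<sigma>. \<sigma> - {x}) ` {\<sigma> \<in> F. x \<in> \<sigma>}" unfolding link_family_def by auto
  moreover have "inj_on (\<lambda>\<sigma>. \<sigma> - {x}) {\<sigma> \<in> F. x \<in> \<sigma>}" by (rule inj_onI) blast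
  ultimately show ?thesis by (simp add: card_image)
qed

lemma card_link_plus_deletion:
  assumes "finite F"
  shows "card (link_family F x) + card (deletion_family F x) = card F"
proof -
  have "F = {\<sigma> \<in> F. x \<in> \<sigma>} \<union> deletion_family F x" unfolding deletion_family_def by auto
  moreover have "card ({\<sigma> \<in> F. x \<in> \<sigma>} \<union> deletion_family F x) = card {\<sigma> \<in> F. x \<in> \<sigma>} + card (deletion_family F x)"
    by (rule card_Un_disjoint) (use assms in \<open>auto simp: deletion_family_def\<close>)
  ultimately show ?thesis by (simp add: card_link_family)
qed

text \<open>
  Removing a point \<open>y\<close> from a member \<open>\<sigma>\<close> leaves a set in the link family if \<open>y = x\<close>, a set in the shadow of
  the deletion family if \<open>x \<notin> \<sigma>\<close>, and otherwise a set that contains \<open>x\<close> and whose rest lies in the shadow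
  of the link family.
\<close>

lemma shadow_split:
  "shadow F = (link_family F x \<union> shadow (deletion_family F x)) \<union> insert x ` shadow (link_family F x)"
proof
  show "shadow F \<subseteq> (link_family F x \<union> shadow (deletion_family F x)) \<union> insert x ` shadow (link_family F x)"
  proof
    fix \<tau> assume "\<tau> \<in> shadow F"
    then obtain \<sigma> y where s: "\<sigma> \<in> F" "y \<in> \<sigma>" "\<tau> = \<sigma> - {y}" unfolding shadow_def by auto
    consider "y = x" | "x \<notin> \<sigma>" | "x \<in> \<sigma>" "y \<noteq> x" by auto
    then show "\<tau> \<in> (link_family F x \<union> shadow (deletion_family F x)) \<union> insert x ` shadow (link_family F x)"
    proof cases
      case 3
      then have "\<tau> = insert x ((\<sigma> - {x}) - {y})" using s by auto
      moreover have "(\<sigma> - {x}) - {y} \<in> shadow (link_family F x)"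
        using s 3 unfolding shadow_def link_family_def by blast
      ultimately show ?thesis by blast
    qed (use s in \<open>auto simp: shadow_def link_family_def deletion_family_def\<close>)
  qed
next
  have "insert x \<tau> \<in> shadow F" if t: "\<tau> \<in> shadow (link_family F x)" for \<tau>
  proof -
    from t obtain \<sigma> y where s: "\<sigma> \<in> F" "x \<in> \<sigma>" "y \<in> \<sigma> - {x}" "\<tau> = \<sigma> - {x} - {y}"
      unfolding shadow_def link_family_def by auto
    then have "insert x \<tau> = \<sigma> - {y}" by auto
    with s show ?thesis unfolding shadow_def by blast
  qed
  then show "(link_family F x \<union> shadow (deletion_family F x)) \<union> insert x ` shadow (link_family F x) \<subseteq> shadow F"
    by (auto simp: shadow_def link_family_def deletion_family_def)
qed

lemma card_shadow_split:
  assumes "F \<subseteq> layer V (Suc k)" "finite V"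
  shows "card (shadow F) = card (link_family F x \<union> shadow (deletion_family F x)) + card (shadow (link_family F x))"
proof -
  have nx: "x \<notin> \<tau>" if "\<tau> \<in> link_family F x \<union> shadow (deletion_family F x) \<union> shadow (link_family F x)" for \<tau>
    using that unfolding shadow_def link_family_def deletion_family_def by auto
  have fin: "finite (shadow F)" using shadow_finite assms by blast
  have "card (shadow F) = card (link_family F x \<union> shadow (deletion_family F x)) + card (insert x ` shadow (link_family F x))"
    using fin nx unfolding shadow_split[of F x] by (intro card_Un_disjoint) auto
  moreover have "inj_on (insert x) (shadow (link_family F x))"
    using nx by (intro inj_onI) (metis UnCI insert_ident)
  ultimately show ?thesis by (simp add: card_image)
qed

lemma shadow_full_layer:
  assumes "finite V" "k < card V"
  shows "shadow (layer V (Suc k)) = layer V k"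
proof
  show "layer V k \<subseteq> shadow (layer V (Suc k))"
  proof
    fix \<tau> assume t: "\<tau> \<in> layer V k"
    then have fin: "finite \<tau>" "\<tau> \<subseteq> V" "card \<tau> = k" using assms by (auto simp: layer_def dest: finite_subset)
    with assms obtain y where y: "y \<in> V" "y \<notin> \<tau>" by (metis nat_neq_iff subset_antisym subsetI)
    then have "insert y \<tau> \<in> layer V (Suc k)" "\<tau> = insert y \<tau> - {y}" using fin by (auto simp: layer_def)
    then show "\<tau> \<in> shadow (layer V (Suc k))" unfolding shadow_def by blast
  qed
qed (use assms shadow_layer in blast)

text \<open>
  Families attaining the bound, built along the cascade: for \<open>n = (b choose Suc k) + r\<close> take all
  \<open>Suc k\<close>-subsets of \<open>{..<b}\<close> and the cone with apex \<open>b\<close> over an optimal family of \<open>r\<close> sets in \<open>{..<b}\<close>.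
  The base of the cone lies in the shadow of the full layer, so only the cone over its own
  shadow is new. (These are the initial segments of the colexicographic order.)
\<close>

lemma optimal_family:
  assumes "n \<le> a choose k"
  shows "\<exists>G. G \<subseteq> layer {..<a} k \<and> card G = n \<and> card (shadow G) = kk k n"
  using assms
proof (induction k arbitrary: n a)
  case 0
  then have "n = 0 \<or> n = 1" by auto
  then show ?case
  proof
    assume "n = 1"
    then show ?thesis by (intro exI[of _ "{{}}"]) (auto simp: layer_0 shadow_def)
  qed (auto intro!: exI[of _ "{}"] simp: shadow_def)
next
  case (Suc k)
  show ?case
  proof (cases "n = 0")
    case True
    then show ?thesis by (auto intro!: exI[of _ "{}"] simp: shadow_def)
  next
    case False
    then obtain b r where d: "n = (b choose Suc k) + r" "r < b choose k" "Suc k \<le> b"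
      using choose_decomp by blast
    obtain G' where G': "G' \<subseteq> layer {..<b} k" "card G' = r" "card (shadow G') = kk k r"
      using Suc.IH[of r b] d by auto
    define G where "G = layer {..<b} (Suc k) \<union> insert b ` G'"
    have nb: "b \<notin> \<tau>" "finite \<tau>" if "\<tau> \<in> layer {..<b} j" for \<tau> j
      using that by (auto simp: layer_def dest: finite_subset)
    have link_family: "link_family G b = G'"
    proof
      show "link_family G b \<subseteq> G'"
      proof
        fix \<tau> assume "\<tau> \<in> link_family G b"
        then obtain \<sigma> where s: "\<sigma> \<in> G" "b \<in> \<sigma>" "\<tau> = \<sigma> - {b}" unfolding link_family_def by blast
        then have "\<sigma> \<in> insert b ` G'" using nb(1) unfolding G_def by blast
        then obtain \<rho> where "\<rho> \<in> G'" "\<sigma> = insert b \<rho>" by blast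
        moreover have "b \<notin> \<rho>" using nb(1) G'(1) calculation(1) by blast
        ultimately show "\<tau> \<in> G'" using s by simp
      qed
      show "G' \<subseteq> link_family G b"
      proof
        fix \<tau> assume "\<tau> \<in> G'"
        then have "\<tau> = insert b \<tau> - {b}" "insert b \<tau> \<in> G" using nb G' by (auto simp: G_def)
        then show "\<tau> \<in> link_family G b" unfolding link_family_def by blast
      qed
    qed
    have deletion_family: "deletion_family G b = layer {..<b} (Suc k)"
      using nb unfolding deletion_family_def G_def by auto
    have Gb: "G \<subseteq> layer {..<Suc b} (Suc k)"
    proof
      fix \<tau> assume "\<tau> \<in> G"
      then consider "\<tau> \<in> layer {..<b} (Suc k)" | \<rho> where "\<rho> \<in> layer {..<b} k" "\<tau> = insert b \<rho>"
        using G'(1) unfolding G_def by blast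
      then show "\<tau> \<in> layer {..<Suc b} (Suc k)"
      proof cases
        case 2
        then have "card \<tau> = Suc (card \<rho>)" using nb by simp
        with 2 show ?thesis unfolding layer_def by auto
      qed (auto simp: layer_def)
    qed
    have finG: "finite G" using Gb layer_finite finite_subset by blast
    have card: "card G = n"
      using card_link_plus_deletion[OF finG, of b] d G' unfolding link_family deletion_family by (simp add: card_layer)
    have "card (shadow G) = card (layer {..<b} k) + card (shadow G')"
      using card_shadow_split[OF Gb, of b] G' d unfolding link_family deletion_family
      by (simp add: shadow_full_layer Un_absorb1)
    then have sh: "card (shadow G) = kk (Suc k) n" using G' d by (simp add: card_layer kk_rec)
    have "G \<subseteq> layer {..<a} (Suc k)"
    proof (cases "b < a")
      case True
      then have "layer {..<Suc b} (Suc k) \<subseteq> layer {..<a} (Suc k)" unfolding layer_def by auto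
      with Gb show ?thesis by blast
    next
      case False
      then have le: "a choose Suc k \<le> b choose Suc k" using choose_mono_left by simp
      with d Suc.prems have "r = 0" and eq: "a choose Suc k = b choose Suc k" by auto
      then have "G' = {}" using G' layer_finite[of "{..<b}" k] by (auto dest: finite_subset)
      have "a = b"
      proof (rule ccontr)
        assume "a \<noteq> b"
        with False have "Suc a \<le> b" by simp
        then have "Suc a choose Suc k \<le> a choose Suc k" using choose_mono_left eq by metis
        then have "a choose k = 0" by simp
        then have "a choose Suc k = 0" by (simp add: binomial_eq_0_iff)
        with eq d show False by (simp add: binomial_eq_0_iff)
      qed
      with \<open>G' = {}\<close> show ?thesis by (simp add: G_def)
    qed
    with card sh show ?thesis by blast
  qed
qed

lemma kk_le_choose:
  assumes "n \<le> a choose Suc k"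
  shows "kk (Suc k) n \<le> a choose k"
proof -
  obtain G where "G \<subseteq> layer {..<a} (Suc k)" "card (shadow G) = kk (Suc k) n"
    using optimal_family[OF assms] by blast
  with shadow_layer[of G "{..<a}" k] show ?thesis
    by (metis card_layer card_lessThan card_mono finite_lessThan layer_finite)
qed

section \<open>Uncrossing\<close>

text \<open>
  Used to move an optimal family so that it reaches outside another one.
\<close>

lemma subset_permutation:
  assumes "finite V" "\<sigma> \<subseteq> V" "\<rho> \<subseteq> V" "card \<sigma> = card \<rho>"
  obtains p where "bij_betw p V V" "p ` \<sigma> = \<rho>"
proof -
  have fin: "finite \<sigma>" "finite \<rho>" using assms finite_subset by auto
  then obtain g where g: "bij_betw g \<sigma> \<rho>" using assms finite_same_card_bij by blast
  have "card (V - \<sigma>) = card (V - \<rho>)" using assms fin by (simp add: card_Diff_subset)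
  then obtain h where h: "bij_betw h (V - \<sigma>) (V - \<rho>)"
    using assms finite_same_card_bij by blast
  define p where "p x = (if x \<in> \<sigma> then g x else h x)" for x
  have p: "bij_betw p \<sigma> \<rho>" "bij_betw p (V - \<sigma>) (V - \<rho>)"
    using g h bij_betw_cong[of \<sigma> p g \<rho>] bij_betw_cong[of "V - \<sigma>" p h "V - \<rho>"]
    by (auto simp: p_def)
  have "bij_betw p (\<sigma> \<union> (V - \<sigma>)) (\<rho> \<union> (V - \<rho>))"
    by (rule bij_betw_combine[OF p]) auto
  moreover have "\<sigma> \<union> (V - \<sigma>) = V" "\<rho> \<union> (V - \<rho>) = V" using assms by auto
  ultimately show ?thesis using that p(1) by (auto simp: bij_betw_def)
qed

lemma permuted_family:
  assumes "finite V" "bij_betw p V V" "F \<subseteq> layer V k"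
  shows "image p ` F \<subseteq> layer V k" "card (image p ` F) = card F"
    "card (shadow (image p ` F)) \<le> card (shadow F)"
proof -
  have inj: "inj_on p V" and im: "p ` V = V" using assms by (auto simp: bij_betw_def)
  show "image p ` F \<subseteq> layer V k"
  proof
    fix \<tau> assume "\<tau> \<in> image p ` F"
    then obtain \<sigma> where s: "\<tau> = p ` \<sigma>" "\<sigma> \<subseteq> V" "card \<sigma> = k"
      using assms(3) unfolding layer_def by auto
    then have "card \<tau> = k" using inj_on_subset[OF inj] card_image by metis
    moreover have "\<tau> \<subseteq> V" using s im by auto
    ultimately show "\<tau> \<in> layer V k" unfolding layer_def by simp
  qed
  have "inj_on (image p) F"
    using inj_on_subset[OF inj_on_image_Pow[OF inj], of F] assms(3) unfolding layer_def by auto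
  then show "card (image p ` F) = card F" by (rule card_image)
  have "shadow (image p ` F) \<subseteq> image p ` shadow F"
  proof
    fix \<tau> assume "\<tau> \<in> shadow (image p ` F)"
    then obtain \<sigma> x where s: "\<sigma> \<in> F" "x \<in> \<sigma>" "\<tau> = p ` \<sigma> - {p x}" unfolding shadow_def by auto
    then have "\<tau> = p ` (\<sigma> - {x})"
      using inj_on_image_set_diff[OF inj, of \<sigma> "{x}"] assms(3) unfolding layer_def by auto
    with s show "\<tau> \<in> image p ` shadow F" unfolding shadow_def by blast
  qed
  then show "card (shadow (image p ` F)) \<le> card (shadow F)"
    using shadow_finite[OF assms(3,1)] by (meson card_image_le card_mono finite_imageI order_trans)
qed

lemma shadow_submodular:
  assumes "finite (shadow F)" "finite (shadow G)"
  shows "card (shadow (F \<union> G)) + card (shadow (F \<inter> G)) \<le> card (shadow F) + card (shadow G)"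
proof -
  have "shadow (F \<union> G) = shadow F \<union> shadow G" unfolding shadow_def by auto
  moreover have "shadow (F \<inter> G) \<subseteq> shadow F \<inter> shadow G" unfolding shadow_def by auto
  ultimately show ?thesis
    using assms card_Un_Int[of "shadow F" "shadow G"] card_mono[of "shadow F \<inter> shadow G" "shadow (F \<inter> G)"]
    by auto
qed

text \<open>
  Two optimal families \<open>R\<close> and \<open>M\<close> in the layer of \<open>k\<close>-sets of \<open>{..<a}\<close>, the second one permuted so
  that it is not contained in the first, have a union larger than \<open>R\<close> and an intersection smaller than
  \<open>M\<close>. Submodularity of the shadow and minimality of \<open>kk\<close> show that replacing the two sizes by
  those of the union and of the intersection does not increase the sum of the \<open>kk\<close> values. This can be
  repeated until the larger size fills the layer or the smaller one is \<open>0\<close>. The first hypothesis,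
  minimality of \<open>kk\<close>, is the Kruskal--Katona theorem for sets of size \<open>k\<close>.
\<close>

lemma kk_exchange:
  assumes KK: "\<And>(V::nat set) F. finite V \<Longrightarrow> F \<subseteq> layer V k \<Longrightarrow> kk k (card F) \<le> card (shadow F)"
    and "r \<le> a choose k" "m \<le> a choose k"
  shows "kk k (min (a choose k) (r + m)) + kk k (r + m - (a choose k)) \<le> kk k r + kk k m"
proof -
  let ?N = "a choose k"
  have ordered: "kk k (min ?N (r + m)) + kk k (r + m - ?N) \<le> kk k r + kk k m"
    if "r \<le> ?N" "m \<le> r" for r m
    using that
  proof (induction m arbitrary: r rule: less_induct)
    case (less m)
    consider "m = 0" | "r = ?N" | "m > 0" "r < ?N" using less.prems by linarith
    then show ?case
    proof cases
      case 3
      obtain R where R: "R \<subseteq> layer {..<a} k" "card R = r" "card (shadow R) = kk k r"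
        using optimal_family less.prems by blast
      obtain M where M: "M \<subseteq> layer {..<a} k" "card M = m" "card (shadow M) = kk k m"
        using optimal_family less.prems order_trans by metis
      have fin: "finite (layer {..<a} k)" by (simp add: layer_finite)
      have "R \<noteq> layer {..<a} k" using R 3 card_layer[of "{..<a}" k] by auto
      then obtain \<rho> where rho: "\<rho> \<in> layer {..<a} k" "\<rho> \<notin> R" using R by blast
      obtain \<sigma> where sig: "\<sigma> \<in> M" using M 3 by fastforce
      obtain p where p: "bij_betw p {..<a} {..<a}" "p ` \<sigma> = \<rho>"
        using subset_permutation[of "{..<a}" \<sigma> \<rho>] sig rho M unfolding layer_def by blast
      define M' where "M' = image p ` M"
      have M': "M' \<subseteq> layer {..<a} k" "card M' = m" "card (shadow M') \<le> kk k m" "\<rho> \<in> M'"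
        using permuted_family[of "{..<a}" p M k] p M sig unfolding M'_def by auto
      define t where "t = card (R \<inter> M')"
      have finR: "finite R" "finite M'" using R M' fin finite_subset by auto
      have "R \<inter> M' \<subset> M'" using M' rho by blast
      then have t: "t < m" unfolding t_def using M' finR psubset_card_mono by blast
      have un: "card (R \<union> M') = r + m - t"
        using card_Un_Int[OF finR] R M' by (simp add: t_def)
      then have "r + m - t \<le> ?N"
        using R M' fin card_mono[of "layer {..<a} k" "R \<union> M'"] by (simp add: card_layer)
      then have "kk k (min ?N (r + m)) + kk k (r + m - ?N) \<le> kk k (r + m - t) + kk k t"
        using less.IH[of t "r + m - t"] t less.prems by simp
      also have "\<dots> \<le> card (shadow (R \<union> M')) + card (shadow (R \<inter> M'))"
        using KK[of "{..<a}" "R \<union> M'"] KK[of "{..<a}" "R \<inter> M'"] R M' un t_def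
        by (intro add_mono) auto
      also have "\<dots> \<le> kk k r + kk k m"
        using shadow_submodular[of R M'] shadow_finite[of R "{..<a}" k] shadow_finite[of M' "{..<a}" k] R M'
        by simp
      finally show ?thesis .
    qed (use less.prems in \<open>auto simp: min_def\<close>)
  qed
  show ?thesis
  proof (cases "m \<le> r")
    case False
    then show ?thesis using ordered[of m r] assms(3) by (simp add: add.commute)
  qed (use ordered assms(2) in blast)
qed

section \<open>The coning inequality\<close>

text \<open>
  The inductive step of the coning inequality for sets of size \<open>Suc k\<close>, from the Kruskal--Katona theorem
  and the coning inequality for sets of size \<open>k\<close>. Write \<open>n = (a choose Suc k) + r\<close> and \<open>N = a choose k\<close>.
  If \<open>r + m \<le> N\<close>, the first block is the same on both sides and the claim is subadditivity of \<open>kk k\<close>.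
  Otherwise \<open>n + m\<close> has the first block \<open>Suc a choose Suc k\<close> and the remainder \<open>s = r + m - N\<close>, and the claim
  becomes \<open>kk k N + kk k s \<le> kk k r + kk k m\<close>. For \<open>m \<le> N\<close> this is the exchange inequality; for
  \<open>m = N + m'\<close> one block cancels and the coning inequality one level below, applied to \<open>r\<close> and \<open>m'\<close>,
  is what remains.
\<close>

lemma kk_cone_step:
  assumes KK: "\<And>(V::nat set) F. finite V \<Longrightarrow> F \<subseteq> layer V k \<Longrightarrow> kk k (card F) \<le> card (shadow F)"
    and IH: "\<And>j n m. k = Suc j \<Longrightarrow> m \<le> kk k n \<Longrightarrow> kk k (n + m) \<le> kk k n + kk j m"
    and m: "m \<le> kk (Suc k) n"
  shows "kk (Suc k) (n + m) \<le> kk (Suc k) n + kk k m"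
proof (cases "n = 0")
  case False
  then obtain a r where d: "n = (a choose Suc k) + r" "r < a choose k" "Suc k \<le> a"
    using choose_decomp by blast
  let ?N = "a choose k"
  have kkn: "kk (Suc k) n = ?N + kk k r" using d kk_rec by simp
  have exchange: "kk k (min ?N (r + m)) + kk k (r + m - ?N) \<le> kk k r + kk k m" if "m \<le> ?N"
  proof (rule kk_exchange)
    show "kk k (card F) \<le> card (shadow F)" if "finite V" "F \<subseteq> layer V k" for V :: "nat set" and F
      using that by (rule KK)
  qed (use d that in auto)
  show ?thesis
  proof (cases "r + m \<le> ?N")
    case True
    then have "kk (Suc k) (n + m) = ?N + kk k (r + m)" using d kk_rec[of k a "r + m"] by (simp add: add.assoc)
    moreover have "kk k (r + m) \<le> kk k r + kk k m"
      using exchange True by simp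
    ultimately show ?thesis using kkn by simp
  next
    case False
    have "k \<noteq> 0" using False m kkn d by (intro notI) auto
    then obtain j where j: "k = Suc j" by (cases k) auto
    obtain b where b: "a = Suc b" "j < b" using d j by (cases a) auto
    have top: "Suc a choose k = ?N + kk k ?N" using j b kk_choose[of j b] by simp
    have kr: "kk k r \<le> a choose j" using kk_le_choose[of r a j] d j by simp
    define s where "s = r + m - ?N"
    have nm: "n + m = (Suc a choose Suc k) + s" using d False by (simp add: s_def)
    \<comment> \<open>The remainder must fit into the next block for the recursion to apply; this is where the
      hypothesis on \<open>m\<close> enters.\<close>
    have "s \<le> r + kk k r" using m kkn by (simp add: s_def)
    also have "\<dots> \<le> Suc a choose k" using kr d j by simp
    finally have "kk (Suc k) (n + m) = ?N + kk k ?N + kk k s"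
      unfolding nm using kk_rec[of k "Suc a" s] d top by (simp del: binomial_Suc_Suc)
    moreover have "kk k ?N + kk k s \<le> kk k r + kk k m"
    proof (cases "m \<le> ?N")
      case True
      then show ?thesis using exchange False unfolding s_def by (simp add: min_def)
    next
      case mN: False
      define m' where "m' = m - ?N"
      have m': "m = ?N + m'" "s = r + m'" "m' \<le> kk k r" using mN m kkn by (auto simp: m'_def s_def)
      have "kk k s \<le> kk k r + kk j m'" using IH j m' by simp
      moreover have "kk k m = kk k ?N + kk j m'"
        using kk_rec[of j a m'] kk_rec[of j a 0] m' kr b j by simp
      ultimately show ?thesis by simp
    qed
    ultimately show ?thesis using kkn by simp
  qed
qed (use m in simp)

section \<open>A vertex of small degree\<close>

lemma sum_degrees:
  assumes "F \<subseteq> layer V k" "finite V"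
  shows "(\<Sum>x\<in>V. card (link_family F x)) = k * card F"
proof -
  have fin: "finite F" using assms layer_finite finite_subset by blast
  have "(\<Sum>x\<in>V. card (link_family F x)) = (\<Sum>x\<in>V. \<Sum>\<sigma>\<in>F. if x \<in> \<sigma> then 1 else 0)"
    unfolding card_link_family using sum.inter_filter[OF fin, of "\<lambda>_. 1::nat", symmetric] by simp
  also have "\<dots> = (\<Sum>\<sigma>\<in>F. \<Sum>x\<in>V. if x \<in> \<sigma> then 1 else 0)" by (rule sum.swap)
  also have "\<dots> = (\<Sum>\<sigma>\<in>F. k)"
  proof (rule sum.cong)
    fix \<sigma> assume "\<sigma> \<in> F"
    then have "\<sigma> \<subseteq> V" "card \<sigma> = k" using assms by (auto simp: layer_def)
    then show "(\<Sum>x\<in>V. if x \<in> \<sigma> then 1 else 0) = k"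
      using assms sum.inter_restrict[of V "\<lambda>_. 1::nat" \<sigma>] by (simp add: Int_absorb1)
  qed simp
  finally show ?thesis by simp
qed

text \<open>
  Let \<open>w\<close> be the number of vertices, \<open>m\<close> the least degree and \<open>n\<close> the size of the deletion family of a
  vertex of that degree. Averaging gives \<open>w * m \<le> Suc k * (m + n)\<close>. The deletion family lives on
  \<open>w - 1\<close> points, where \<open>Suc k * n \<le> kk (Suc k) n * (w - Suc k)\<close>. Hence
  \<open>m * (w - Suc k) \<le> kk (Suc k) n * (w - Suc k)\<close>, and the factor can be cancelled because two distinct sets
  of size \<open>Suc k\<close> need more than \<open>Suc k\<close> points. For a single set the lemma fails: its deletion
  families are empty.
\<close>

lemma small_degree_vertex:
  assumes "F \<subseteq> layer V (Suc k)" "finite V" "card F \<ge> 2"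
  obtains x where "x \<in> \<Union>F" "card (link_family F x) \<le> kk (Suc k) (card (deletion_family F x))"
proof -
  let ?W = "\<Union>F"
  \<comment> \<open>\<open>V\<close> may contain points of degree \<open>0\<close>; the average must be taken over the covered ones.\<close>
  have W: "finite ?W" "F \<subseteq> layer ?W (Suc k)"
  proof -
    have "?W \<subseteq> V" using assms by (auto simp: layer_def)
    then show "finite ?W" using assms(2) finite_subset by blast
    show "F \<subseteq> layer ?W (Suc k)" using assms by (auto simp: layer_def)
  qed
  have fin: "finite F" using W layer_finite finite_subset by blast
  have "card ?W > Suc k"
  proof (rule ccontr)
    assume "\<not> card ?W > Suc k"
    then have "card ?W choose Suc k \<le> 1" using choose_mono_left[of "card ?W" "Suc k" "Suc k"] by simp
    then show False using card_mono[OF layer_finite W(2)] W assms(3) by (simp add: card_layer)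
  qed
  then have ne: "?W \<noteq> {}" by (metis card.empty not_less0)
  let ?x = "arg_min_on (\<lambda>x. card (link_family F x)) ?W"
  obtain x where x: "x \<in> ?W" "\<And>y. y \<in> ?W \<Longrightarrow> card (link_family F x) \<le> card (link_family F y)"
  proof
    show "?x \<in> ?W" using W(1) ne by (rule arg_min_if_finite(1))
    show "card (link_family F ?x) \<le> card (link_family F y)" if "y \<in> ?W" for y
      using W(1) ne that by (rule arg_min_least)
  qed
  let ?m = "card (link_family F x)" and ?n = "card (deletion_family F x)" and ?w = "card ?W - 1"
  have "card ?W * ?m \<le> (\<Sum>y\<in>?W. card (link_family F y))" using x sum_bounded_below[of ?W ?m] by simp
  also have "\<dots> = Suc k * (?m + ?n)"
    using sum_degrees[OF W(2,1)] card_link_plus_deletion[OF fin] by simp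
  finally have deg: "card ?W * ?m \<le> Suc k * ?m + Suc k * ?n" by (simp add: algebra_simps)
  have "?n \<le> ?w choose Suc k"
    using card_mono[OF layer_finite deletion_family_layer[OF W(2)], of x] W x by (simp add: card_layer)
  then have "Suc k * ?n \<le> kk (Suc k) ?n * (Suc ?w - Suc k)" by (rule kk_local_bound)
  also have "Suc ?w - Suc k = card ?W - Suc k" using \<open>card ?W > Suc k\<close> by simp
  finally have "card ?W * ?m - Suc k * ?m \<le> kk (Suc k) ?n * (card ?W - Suc k)" using deg by linarith
  then have "?m * (card ?W - Suc k) \<le> kk (Suc k) ?n * (card ?W - Suc k)"
    by (simp add: diff_mult_distrib2 mult.commute)
  then have "?m \<le> kk (Suc k) ?n" using \<open>card ?W > Suc k\<close> by simp
  then show ?thesis using that x by blast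
qed

section \<open>The Kruskal--Katona theorem and its equality case\<close>

lemma kk_single: "kk (Suc k) 1 = Suc k"
  using kk_choose[of k k] by simp

text \<open>
  Split the family at a vertex of small degree and bound the two parts by induction, on the
  number of sets for the deletion family and on their size for the link family; the coning inequality
  puts the two bounds together. The vertex type is arbitrary here, since the coning inequality is
  purely numerical, whereas its own proof uses the theorem for sets of natural numbers.
\<close>

lemma kruskal_katona_if_cone:
  assumes cone: "\<And>j n m. j < k \<Longrightarrow> m \<le> kk (Suc j) n \<Longrightarrow> kk (Suc j) (n + m) \<le> kk (Suc j) n + kk j m"
    and "finite V" "F \<subseteq> layer V k"
  shows "kk k (card F) \<le> card (shadow F)"
  using assms
proof (induction k arbitrary: V F)
  case (Suc k)
  show ?case using Suc.prems(2,3)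
  proof (induction "card F" arbitrary: F rule: less_induct)
    case less
    have fin: "finite F" using less.prems layer_finite finite_subset by blast
    consider "card F = 0" | "card F = 1" | "card F \<ge> 2" by linarith
    then show ?case
    proof cases
      case 2
      then obtain \<sigma> where F: "F = {\<sigma>}" using card_1_singletonE by blast
      then have "card \<sigma> = Suc k" using less.prems by (auto simp: layer_def)
      have "shadow F = (\<lambda>x. \<sigma> - {x}) ` \<sigma>" unfolding shadow_def F by auto
      moreover have "inj_on (\<lambda>x. \<sigma> - {x}) \<sigma>" by (rule inj_onI) auto
      ultimately show ?thesis using 2 \<open>card \<sigma> = Suc k\<close> kk_single by (simp add: card_image)
    next
      case 3
      obtain x where x: "x \<in> \<Union>F" "card (link_family F x) \<le> kk (Suc k) (card (deletion_family F x))"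
        using small_degree_vertex less.prems 3 by metis
      have av: "deletion_family F x \<subseteq> layer V (Suc k)" using less.prems by (auto simp: deletion_family_def)
      have st: "link_family F x \<subseteq> layer (V - {x}) k" using link_family_layer[OF less.prems(2,1)] .
      have "deletion_family F x \<subset> F" using x unfolding deletion_family_def by auto
      then have "kk (Suc k) (card (deletion_family F x)) \<le> card (shadow (deletion_family F x))"
        using less fin av psubset_card_mono by metis
      also have "\<dots> \<le> card (link_family F x \<union> shadow (deletion_family F x))"
        using shadow_finite[OF av] finite_subset[OF st] layer_finite[of "V - {x}" k] less.prems
        by (intro card_mono) auto
      finally have 1: "kk (Suc k) (card (deletion_family F x)) \<le> card (link_family F x \<union> shadow (deletion_family F x))" .
      have 2: "kk k (card (link_family F x)) \<le> card (shadow (link_family F x))"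
        using Suc.IH[of "V - {x}" "link_family F x"] Suc.prems(1) st less.prems by simp
      have "kk (Suc k) (card F) \<le> kk (Suc k) (card (deletion_family F x)) + kk k (card (link_family F x))"
        using Suc.prems(1)[OF _ x(2)] card_link_plus_deletion[OF fin, of x] by (simp add: add.commute)
      also have "\<dots> \<le> card (shadow F)"
        using 1 2 card_shadow_split[OF less.prems(2,1), of x] by linarith
      finally show ?thesis .
    qed simp
  qed
qed simp

lemma kk_cone: "m \<le> kk (Suc k) n \<Longrightarrow> kk (Suc k) (n + m) \<le> kk (Suc k) n + kk k m"
proof (induction k arbitrary: n m rule: less_induct)
  case (less k)
  show ?case
  proof (rule kk_cone_step)
    show "kk k (card F) \<le> card (shadow F)" if "finite V" "F \<subseteq> layer V k" for V :: "nat set" and F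
      using kruskal_katona_if_cone[of k V F] less.IH that by blast
    show "kk k (n + m) \<le> kk k n + kk j m" if "k = Suc j" "m \<le> kk k n" for j n m
      using less.IH[of j] that by blast
  qed (rule less.prems)
qed

theorem kruskal_katona:
  "finite V \<Longrightarrow> F \<subseteq> layer V k \<Longrightarrow> kk k (card F) \<le> card (shadow F)"
  by (rule kruskal_katona_if_cone) (rule kk_cone)

text \<open>
  For an extremal family every inequality in the proof of the Kruskal--Katona theorem is an
  equality. So both parts are extremal, and \<open>|L \<union> shadow D| = |shadow D|\<close> for the link family \<open>L\<close> and the
  deletion family \<open>D\<close>, which forces \<open>L \<subseteq> shadow D\<close>.
\<close>

lemma extremal_family_split:
  assumes "finite V" "F \<subseteq> layer V (Suc k)" "card F \<ge> 2" "card (shadow F) \<le> kk (Suc k) (card F)"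
  obtains x where "x \<in> \<Union>F" "deletion_family F x \<noteq> {}" "link_family F x \<subseteq> shadow (deletion_family F x)"
    "card (shadow (deletion_family F x)) \<le> kk (Suc k) (card (deletion_family F x))"
    "card (shadow (link_family F x)) \<le> kk k (card (link_family F x))"
proof -
  obtain x where x: "x \<in> \<Union>F" "card (link_family F x) \<le> kk (Suc k) (card (deletion_family F x))"
    using small_degree_vertex assms by metis
  let ?A = "deletion_family F x" and ?S = "link_family F x"
  have fin: "finite F" using assms layer_finite finite_subset by blast
  have av: "?A \<subseteq> layer V (Suc k)" using assms by (auto simp: deletion_family_def)
  have st: "?S \<subseteq> layer (V - {x}) k" using link_family_layer[OF assms(2,1)] .
  have finU: "finite (?S \<union> shadow ?A)"
    using shadow_finite[OF av] finite_subset[OF st] layer_finite[of "V - {x}" k] assms by auto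
  have "kk (Suc k) (card F) \<le> kk (Suc k) (card ?A) + kk k (card ?S)"
    using kk_cone[OF x(2)] card_link_plus_deletion[OF fin, of x] by (simp add: add.commute)
  moreover have "kk (Suc k) (card ?A) \<le> card (shadow ?A)" by (rule kruskal_katona[OF assms(1) av])
  moreover have "kk k (card ?S) \<le> card (shadow ?S)"
    by (rule kruskal_katona[OF _ st]) (use assms(1) in simp)
  moreover have "card (shadow ?A) \<le> card (?S \<union> shadow ?A)" using finU by (intro card_mono) auto
  moreover have "card (shadow F) = card (?S \<union> shadow ?A) + card (shadow ?S)"
    by (rule card_shadow_split[OF assms(2,1)])
  ultimately have eq: "card (?S \<union> shadow ?A) = card (shadow ?A)"
    "card (shadow ?A) \<le> kk (Suc k) (card ?A)" "card (shadow ?S) \<le> kk k (card ?S)"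
    using assms(4) by linarith+
  then have "shadow ?A = ?S \<union> shadow ?A" using finU by (intro card_subset_eq) auto
  moreover have "?A \<noteq> {}"
  proof
    assume "?A = {}"
    then have "card ?S = 0" using x(2) by (simp only: card.empty kk_zero)
    then show False using \<open>?A = {}\<close> card_link_plus_deletion[OF fin, of x] assms(3) by simp
  qed
  ultimately show ?thesis using that x(1) eq by blast
qed

section \<open>Vertex decomposability\<close>

definition generated_complex :: "'a set set \<Rightarrow> 'a set set" where
  "generated_complex F = {\<tau>. \<exists>\<sigma>\<in>F. \<tau> \<subseteq> \<sigma>}"

lemma generated_complex_singleton: "generated_complex {\<sigma>} = Pow \<sigma>"
  unfolding generated_complex_def by auto

lemma facets_generated_complex:
  assumes "finite V" "F \<subseteq> layer V k"
  shows "facets (generated_complex F) = F"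
proof
  show "facets (generated_complex F) \<subseteq> F" unfolding facets_def generated_complex_def by blast
  have "\<tau> = \<sigma>" if "\<sigma> \<in> F" "\<sigma>' \<in> F" "\<tau> \<subseteq> \<sigma>'" "\<sigma> \<subseteq> \<tau>" for \<sigma> \<sigma>' \<tau>
  proof -
    have "finite \<sigma>'" "card \<sigma> = card \<sigma>'" using assms that by (auto simp: layer_def dest: finite_subset)
    then have "\<sigma> = \<sigma>'" using that by (intro card_subset_eq) auto
    with that show ?thesis by auto
  qed
  then show "F \<subseteq> facets (generated_complex F)" unfolding facets_def generated_complex_def by auto
qed

lemma pure_generated_complex:
  assumes "finite V" "F \<subseteq> layer V k"
  shows "pure_complex (generated_complex F)"
  using assms(2) unfolding pure_complex_def facets_generated_complex[OF assms] face_dim_def layer_def by auto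

lemma simplicial_generated_complex:
  assumes "finite V" "F \<subseteq> layer V k"
  shows "simplicial_complex (generated_complex F)"
proof -
  have "generated_complex F \<subseteq> Pow V" using assms unfolding generated_complex_def layer_def by blast
  then show ?thesis using assms(1) unfolding simplicial_complex_def generated_complex_def by blast
qed

lemma link_generated_complex: "link (generated_complex F) {x} = generated_complex (link_family F x)"
proof
  show "link (generated_complex F) {x} \<subseteq> generated_complex (link_family F x)"
  proof
    fix \<tau> assume "\<tau> \<in> link (generated_complex F) {x}"
    then obtain \<sigma> where s: "\<sigma> \<in> F" "\<tau> \<union> {x} \<subseteq> \<sigma>" "x \<notin> \<tau>" unfolding link_def generated_complex_def by auto
    then have "\<tau> \<subseteq> \<sigma> - {x}" "\<sigma> - {x} \<in> link_family F x" unfolding link_family_def by auto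
    then show "\<tau> \<in> generated_complex (link_family F x)" unfolding generated_complex_def by blast
  qed
  show "generated_complex (link_family F x) \<subseteq> link (generated_complex F) {x}"
  proof
    fix \<tau> assume "\<tau> \<in> generated_complex (link_family F x)"
    then obtain \<sigma> where "\<sigma> \<in> F" "x \<in> \<sigma>" "\<tau> \<subseteq> \<sigma> - {x}" unfolding link_family_def generated_complex_def by auto
    then have "\<tau> \<in> generated_complex F" "\<tau> \<inter> {x} = {}" "\<tau> \<union> {x} \<in> generated_complex F" unfolding generated_complex_def by auto
    then show "\<tau> \<in> link (generated_complex F) {x}" unfolding link_def by simp
  qed
qed

text \<open>
  A face of the deletion may come only from sets that contain \<open>x\<close>; the hypothesis places it below a
  set that avoids \<open>x\<close>.
\<close>

lemma deletion_generated_complex: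
  assumes "link_family F x \<subseteq> generated_complex (deletion_family F x)"
  shows "deletion (generated_complex F) x = generated_complex (deletion_family F x)"
proof
  show "deletion (generated_complex F) x \<subseteq> generated_complex (deletion_family F x)"
  proof
    fix \<tau> assume "\<tau> \<in> deletion (generated_complex F) x"
    then obtain \<sigma> where s: "\<sigma> \<in> F" "\<tau> \<subseteq> \<sigma>" "x \<notin> \<tau>" unfolding deletion_def generated_complex_def by auto
    show "\<tau> \<in> generated_complex (deletion_family F x)"
    proof (cases "x \<in> \<sigma>")
      case True
      then have "\<sigma> - {x} \<in> generated_complex (deletion_family F x)" using s assms unfolding link_family_def by blast
      moreover have "\<tau> \<subseteq> \<sigma> - {x}" using s by auto
      ultimately show ?thesis unfolding generated_complex_def by blast
    qed (use s in \<open>auto simp: generated_complex_def deletion_family_def\<close>)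
  qed
qed (auto simp: deletion_def generated_complex_def deletion_family_def)

lemma shed_generated_complex:
  assumes "finite V" "F \<subseteq> layer V (Suc k)" "x \<in> \<Union>F" "link_family F x \<subseteq> generated_complex (deletion_family F x)"
    "vertex_decomposable (generated_complex (link_family F x))" "vertex_decomposable (generated_complex (deletion_family F x))"
  shows "vertex_decomposable (generated_complex F)"
proof (rule vertex_decomposable.shed[where x = x])
  show "{x} \<in> generated_complex F" using assms(3) unfolding generated_complex_def by auto
  show "pure_complex (link (generated_complex F) {x})" unfolding link_generated_complex
    by (rule pure_generated_complex[OF _ link_family_layer[OF assms(2,1)]]) (use assms(1) in simp)
  show "pure_complex (deletion (generated_complex F) x)" unfolding deletion_generated_complex[OF assms(4)]
    by (rule pure_generated_complex[OF _ deletion_family_layer[OF assms(2)]]) (use assms(1) in simp)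
qed (use assms(5,6) simplicial_generated_complex[OF assms(1,2)] pure_generated_complex[OF assms(1,2)]
    in \<open>simp_all add: link_generated_complex deletion_generated_complex[OF assms(4)]\<close>)

text \<open>
  A simplex is a cone with any vertex as apex, and the link and the deletion of the apex coincide.
\<close>

lemma simplex_vertex_decomposable: "finite \<sigma> \<Longrightarrow> vertex_decomposable (Pow \<sigma>)"
proof (induction \<sigma> rule: finite_induct)
  case empty
  show ?case using vertex_decomposable.empty_face by simp
next
  case (insert x \<sigma>)
  have link: "link (Pow (insert x \<sigma>)) {x} = Pow \<sigma>" and del: "deletion (Pow (insert x \<sigma>)) x = Pow \<sigma>"
    using insert.hyps unfolding link_def deletion_def by auto
  have "pure_complex (Pow \<tau>)" if "finite \<tau>" for \<tau> :: "'a set"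
    using pure_generated_complex[of \<tau> "{\<tau>}" "card \<tau>"] that by (simp add: generated_complex_singleton layer_def)
  moreover have "simplicial_complex (Pow (insert x \<sigma>))"
    using insert.hyps unfolding simplicial_complex_def by auto
  moreover have "{x} \<in> Pow (insert x \<sigma>)" by simp
  ultimately show ?case using insert.IH insert.hyps(1) vertex_decomposable.shed[of "Pow (insert x \<sigma>)" x]
    unfolding link del by (metis finite_insert)
qed

text \<open>
  Extremality passes to the link and the deletion family of the vertex found in
  \<open>extremal_family_split\<close>, so the induction is on the size of the sets and then on their number. A single
  set has no such vertex and is treated as a simplex.
\<close>

lemma extremal_family_vertex_decomposable:
  assumes "finite V" "F \<subseteq> layer V k" "F \<noteq> {}" "card (shadow F) \<le> kk k (card F)"
  shows "vertex_decomposable (generated_complex F)"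
  using assms
proof (induction k arbitrary: V F)
  case 0
  then have "F = {{}}" by (auto simp: layer_0)
  then show ?case by (simp add: generated_complex_singleton vertex_decomposable.empty_face)
next
  case (Suc k)
  show ?case using Suc.prems(2-)
  proof (induction "card F" arbitrary: F rule: less_induct)
    case less
    have fin: "finite F" using less.prems Suc.prems(1) layer_finite finite_subset by blast
    show ?case
    proof (cases "card F = 1")
      case True
      then obtain \<sigma> where "F = {\<sigma>}" using card_1_singletonE by blast
      moreover have "finite \<sigma>" using calculation less.prems Suc.prems(1)
        by (auto simp: layer_def dest: finite_subset)
      ultimately show ?thesis by (simp add: generated_complex_singleton simplex_vertex_decomposable)
    next
      case False
      then have "card F \<ge> 2" using less.prems fin
        by (metis One_nat_def card_0_eq less_2_cases not_less)
      then obtain x where x: "x \<in> \<Union>F" "deletion_family F x \<noteq> {}" "link_family F x \<subseteq> shadow (deletion_family F x)"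
        "card (shadow (deletion_family F x)) \<le> kk (Suc k) (card (deletion_family F x))"
        "card (shadow (link_family F x)) \<le> kk k (card (link_family F x))"
        using extremal_family_split Suc.prems(1) less.prems by metis
      have av: "deletion_family F x \<subseteq> layer V (Suc k)" using less.prems by (auto simp: deletion_family_def)
      have "deletion_family F x \<subset> F" using x unfolding deletion_family_def by auto
      then have "vertex_decomposable (generated_complex (deletion_family F x))"
        using less.hyps[OF psubset_card_mono[OF fin] av x(2,4)] by simp
      moreover have "vertex_decomposable (generated_complex (link_family F x))"
      proof (rule Suc.IH)
        show "link_family F x \<subseteq> layer (V - {x}) k" using link_family_layer[OF less.prems(1) Suc.prems(1)] .
        show "link_family F x \<noteq> {}" using x(1) unfolding link_family_def by auto
      qed (use x Suc.prems(1) in auto)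
      moreover have "link_family F x \<subseteq> generated_complex (deletion_family F x)"
        using x(3) unfolding shadow_def generated_complex_def by blast
      ultimately show ?thesis
        using shed_generated_complex[OF Suc.prems(1) less.prems(1) x(1)] by simp
    qed
  qed
qed

section \<open>Extremal complexes\<close>

lemma faces_of_dim_generated_complex:
  assumes "finite V" "F \<subseteq> layer V k"
  shows "faces_of_dim (int k - 1) (generated_complex F) = F" "faces_of_dim (int k - 2) (generated_complex F) = shadow F"
proof -
  have fs: "finite \<sigma>" "card \<sigma> = k" if "\<sigma> \<in> F" for \<sigma>
    using that assms by (auto simp: layer_def dest: finite_subset)
  show "faces_of_dim (int k - 1) (generated_complex F) = F"
  proof
    show "faces_of_dim (int k - 1) (generated_complex F) \<subseteq> F"
    proof
      fix \<tau> assume "\<tau> \<in> faces_of_dim (int k - 1) (generated_complex F)"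
      then obtain \<sigma> where s: "\<sigma> \<in> F" "\<tau> \<subseteq> \<sigma>" "card \<tau> = k"
        unfolding faces_of_dim_def generated_complex_def face_dim_def by auto
      then have "\<tau> = \<sigma>" using fs by (intro card_subset_eq) auto
      with s show "\<tau> \<in> F" by simp
    qed
  qed (use fs in \<open>auto simp: faces_of_dim_def generated_complex_def face_dim_def\<close>)
  show "faces_of_dim (int k - 2) (generated_complex F) = shadow F"
  proof
    show "faces_of_dim (int k - 2) (generated_complex F) \<subseteq> shadow F"
    proof
      fix \<tau> assume "\<tau> \<in> faces_of_dim (int k - 2) (generated_complex F)"
      then obtain \<sigma> where s: "\<sigma> \<in> F" "\<tau> \<subseteq> \<sigma>" "Suc (card \<tau>) = k"
        unfolding faces_of_dim_def generated_complex_def face_dim_def by auto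
      have "card (\<sigma> - \<tau>) = 1" using s fs[OF s(1)] by (simp add: card_Diff_subset finite_subset)
      then obtain y where "\<sigma> - \<tau> = {y}" using card_1_singletonE by blast
      then have "y \<in> \<sigma>" "\<tau> = \<sigma> - {y}" using s by auto
      with s show "\<tau> \<in> shadow F" unfolding shadow_def by blast
    qed
    show "shadow F \<subseteq> faces_of_dim (int k - 2) (generated_complex F)"
    proof
      fix \<tau> assume "\<tau> \<in> shadow F"
      then obtain \<sigma> x where s: "\<sigma> \<in> F" "x \<in> \<sigma>" "\<tau> = \<sigma> - {x}" unfolding shadow_def by blast
      then have "card \<sigma> = Suc (card \<tau>)" using fs by (metis card_Suc_Diff1)
      then show "\<tau> \<in> faces_of_dim (int k - 2) (generated_complex F)"
        using s fs unfolding faces_of_dim_def generated_complex_def face_dim_def by auto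
    qed
  qed
qed

lemma generated_complex_facets:
  assumes "simplicial_complex \<Delta>"
  shows "generated_complex (facets \<Delta>) = \<Delta>"
proof
  show "generated_complex (facets \<Delta>) \<subseteq> \<Delta>"
    using assms unfolding simplicial_complex_def generated_complex_def facets_def by blast
  have fin: "finite \<Delta>" using assms unfolding simplicial_complex_def
    by (meson finite_Pow_iff finite_subset)
  show "\<Delta> \<subseteq> generated_complex (facets \<Delta>)"
  proof
    fix \<tau> assume "\<tau> \<in> \<Delta>"
    then obtain \<sigma> where "\<sigma> \<in> \<Delta>" "\<tau> \<subseteq> \<sigma>" "\<forall>\<rho>\<in>\<Delta>. \<sigma> \<subseteq> \<rho> \<longrightarrow> \<sigma> = \<rho>"
      using finite_has_maximal2[OF fin] by metis
    then show "\<tau> \<in> generated_complex (facets \<Delta>)" unfolding generated_complex_def facets_def by blast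
  qed
qed

lemma pure_facets_layer:
  assumes "simplicial_complex \<Delta>" "\<Delta> \<noteq> {}" "pure_complex \<Delta>"
  obtains V k where "finite V" "facets \<Delta> \<subseteq> layer V k" "facets \<Delta> \<noteq> {}" "complex_dim \<Delta> = int k - 1"
proof -
  obtain V where V: "finite V" "\<Delta> \<subseteq> Pow V"
    using assms(1) unfolding simplicial_complex_def by (elim conjE exE)
  then have fin: "finite \<Delta>" by (meson finite_Pow_iff finite_subset)
  have ne: "facets \<Delta> \<noteq> {}" using generated_complex_facets[OF assms(1)] assms(2) unfolding generated_complex_def by auto
  then obtain \<sigma> where s: "\<sigma> \<in> facets \<Delta>" by blast
  let ?k = "card \<sigma>"
  have lay: "facets \<Delta> \<subseteq> layer V ?k"
  proof
    fix \<rho> assume r: "\<rho> \<in> facets \<Delta>"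
    then have "face_dim \<rho> = face_dim \<sigma>" using assms(3) s unfolding pure_complex_def by blast
    moreover have "\<rho> \<subseteq> V" using r V(2) unfolding facets_def by auto
    ultimately show "\<rho> \<in> layer V ?k" unfolding face_dim_def layer_def by simp
  qed
  have "face_dim \<tau> \<le> face_dim \<sigma>" if t: "\<tau> \<in> \<Delta>" for \<tau>
  proof -
    obtain \<rho> where r: "\<rho> \<in> facets \<Delta>" "\<tau> \<subseteq> \<rho>"
      using t generated_complex_facets[OF assms(1)] unfolding generated_complex_def by blast
    then have "finite \<rho>" "card \<rho> = ?k" using lay V by (auto simp: layer_def dest: finite_subset)
    with card_mono[OF this(1) r(2)] show ?thesis unfolding face_dim_def by simp
  qed
  moreover have "\<sigma> \<in> \<Delta>" using s unfolding facets_def by auto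
  ultimately have "complex_dim \<Delta> = face_dim \<sigma>"
    unfolding complex_dim_def using fin by (intro Max_eqI) auto
  then show ?thesis using that V(1) lay ne unfolding face_dim_def by blast
qed

text \<open>
  Comparing with the complex generated by an optimal family shows that the facets of an extremal
  complex have a shadow of size at most \<open>kk\<close>.
\<close>

theorem theorem4p14:
  fixes \<Delta> :: "'a set set"
  assumes "extremal \<Delta>"
  shows "vertex_decomposable \<Delta>"
proof -
  let ?F = "facets \<Delta>"
  have D: "simplicial_complex \<Delta>" "\<Delta> \<noteq> {}" "pure_complex \<Delta>"
    using assms unfolding extremal_def by auto
  obtain V k where F: "finite V" "?F \<subseteq> layer V k" "?F \<noteq> {}" "complex_dim \<Delta> = int k - 1"
    using pure_facets_layer[OF D] by blast
  have eq: "generated_complex ?F = \<Delta>" using generated_complex_facets D(1) .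
  have "card ?F \<le> card V choose k"
    using card_mono[OF layer_finite F(2)] F(1) by (simp add: card_layer)
  then obtain G where G: "G \<subseteq> layer {..<card V} k" "card G = card ?F" "card (shadow G) = kk k (card ?F)"
    using optimal_family by metis
  note G_generated_complex = faces_of_dim_generated_complex[OF finite_lessThan G(1)]
  have "card (faces_of_dim (complex_dim \<Delta> - 1) \<Delta>) \<le> card (faces_of_dim (complex_dim \<Delta> - 1) \<Gamma>)"
    if "simplicial_complex \<Gamma>" "card (faces_of_dim (complex_dim \<Delta>) \<Gamma>) = card ?F" for \<Gamma> :: "nat set set"
    using assms that unfolding extremal_def Let_def by blast
  from this[of "generated_complex G"]
  have "card (faces_of_dim (int k - 2) \<Delta>) \<le> card (faces_of_dim (int k - 2) (generated_complex G))"
    using simplicial_generated_complex[OF finite_lessThan G(1)] by (simp add: F(4) G_generated_complex(1) G(2))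
  then have "card (shadow ?F) \<le> kk k (card ?F)"
    using G_generated_complex(2) faces_of_dim_generated_complex(2)[OF F(1,2)] G(3) eq by simp
  then show ?thesis using extremal_family_vertex_decomposable[OF F(1-3)] eq by simp
qed

end
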